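(* Let $\mathcal{H}$ be a Hilbert space of vector-valued functions of $\eta$ with norm $\|\cdot\|$, let $N_1,N_2,\dots$ be fixed real parameters, and let $\mathbf{F}_0=\mathbf{F}_0(\eta)$ and $\mathbf{F}_s=\mathbf{F}_s(\eta,N_1,\dots,N_s)$, $s\ge 1$, be elements of $\mathcal{H}$. Let $\{\mathbf{H}_0,\mathbf{H}_1,\mathbf{H}_2,\dots\}$ be the sequence in $\mathcal{H}$ given by $\mathbf{H}_0=\mathbf{F}_0$ and $\mathbf{H}_s=\mathbf{F}_0+\mathbf{F}_1+\cdots+\mathbf{F}_s$ for $s\ge 1$. Suppose that there exist a constant $\delta$ with $0<\delta<1$ and some $m\in\mathbb{N}$ such that $$\|\mathbf{F}_{s+1}(\eta,N_1,\dots,N_{s+1})\|\le \delta\,\|\mathbf{F}_s(\eta,N_1,\dots,N_s)\|\qquad\text{for all } s\ge m .$$ Then the series $\mathbf{F}_0+\sum_{s=1}^{\infty}\mathbf{F}_s(\eta,N_1,\dots,N_s)$ converges in $\mathcal{H}$, i.e. the sequence $(\mathbf{H}_s)_{s\ge 0}$ converges in $\mathcal{H}$.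
   Context: In the optimal homotopy asymptotic method (OHAM), the approximate solution of a vector differential equation is sought as a series $\mathbf{F}_0(\eta)+q\mathbf{F}_1(\eta,N_1)+q^2\mathbf{F}_2(\eta,N_1,N_2)+\cdots$ in a homotopy parameter $q\in[0,1]$, where the real numbers $N_1,N_2,\dots$ are called convergence parameters; the series solution is obtained by setting $q=1$. Here each $\mathbf{F}_s$ is an $m'$-component vector-valued function of $\eta$ ($m'$ a fixed positive integer), regarded as an element of a Hilbert space $\mathcal{H}$. For the statement, the $\mathbf{F}_s$ are arbitrary elements of $\mathcal{H}$ satisfying the displayed inequality; the parameters $N_i$ are fixed. *)

theory Defs
  imports "HOL-Analysis.Analysis"
begin

text \<open>
  A Hilbert space is a type of sort \<open>{real_inner, complete_space}\<close>; its elements may, for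
  instance, be (classes of) vector-valued functions of \<open>\<eta>\<close>.  The \<open>s\<close>-th term of the series is
  \<open>F s\<close> applied to the list \<open>[N 1, \<dots>, N s]\<close>, so that it depends on the first \<open>s\<close> convergence
  parameters only; \<open>N 0\<close> is never used and \<open>F 0\<close> is applied to the empty list.
\<close>

definition oham_term ::
    "(nat \<Rightarrow> real list \<Rightarrow> 'h) \<Rightarrow> (nat \<Rightarrow> real) \<Rightarrow> nat \<Rightarrow> 'h" where
  "oham_term F N s = F s (map N [1..<Suc s])"

definition oham_partial_sum ::
    "(nat \<Rightarrow> real list \<Rightarrow> 'h::real_normed_vector) \<Rightarrow> (nat \<Rightarrow> real) \<Rightarrow> nat \<Rightarrow> 'h" where
  "oham_partial_sum F N s = (\<Sum>k\<le>s. oham_term F N k)"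

end

theory Submission
  imports Defs
begin

text \<open>
  The class \<open>banach\<close> is not implied by the sort \<open>{real_normed_vector, complete_space}\<close>, so the
  library's \<open>summable_norm_cancel\<close> and \<open>summable_ratio_test\<close> do not apply at this sort.
\<close>

lemma summable_norm_cancel_complete:
  fixes f :: "nat \<Rightarrow> 'a::{real_normed_vector, complete_space}"
  assumes "summable (\<lambda>n. norm (f n))"
  shows "summable f"
proof -
  have "Cauchy (\<lambda>n. \<Sum>k<n. f k)"
  \<comment> \<open>\<open>CauchyI'\<close> only asks about pairs i < n, so each difference of
    partial sums is one block of the series; the triangle inequality bounds it by the same block of
    the series of norms.\<close>
  proof (rule CauchyI')
    fix e :: real
    assume "0 < e"
    then obtain M where M: "norm (\<Sum>k = i..<n. norm (f k)) < e" if "i \<ge> M" for i n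
      using assms unfolding summable_Cauchy by blast
    have "norm ((\<Sum>k<i. f k) - (\<Sum>k<n. f k)) < e" if "i \<ge> M" "i < n" for i n
    proof -
      have "(\<Sum>k<n. f k) - (\<Sum>k<i. f k) = (\<Sum>k = i..<n. f k)"
        using sum_diff_nat_ivl[of 0 i n f] that by (simp add: lessThan_atLeast0)
      then have "norm ((\<Sum>k<i. f k) - (\<Sum>k<n. f k)) = norm (\<Sum>k = i..<n. f k)"
        by (metis norm_minus_commute)
      also have "\<dots> \<le> (\<Sum>k = i..<n. norm (f k))"
        by (rule norm_sum)
      also have "\<dots> < e"
        using M[OF \<open>i \<ge> M\<close>, of n] by simp
      finally show ?thesis .
    qed
    then show "\<exists>M. \<forall>i\<ge>M. \<forall>n>i. dist (\<Sum>k<i. f k) (\<Sum>k<n. f k) < e"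
      unfolding dist_norm by blast
  qed
  then show ?thesis
    by (simp add: summable_iff_convergent Cauchy_convergent)
qed

theorem theorem3p1:
  fixes F :: "nat \<Rightarrow> real list \<Rightarrow> 'h::{real_inner, complete_space}"
    and N :: "nat \<Rightarrow> real"
    and \<delta> :: real
    and m :: nat
  assumes "0 < \<delta>" and "\<delta> < 1"
    and "\<And>s. s \<ge> m \<Longrightarrow> norm (oham_term F N (Suc s)) \<le> \<delta> * norm (oham_term F N s)"
  shows "summable (oham_term F N) \<and> convergent (oham_partial_sum F N)"
proof -
  \<comment> \<open>The ratio test is applied to the real series of norms, where the outer norm is
    trivial and the limit is taken in the reals.\<close>
  have "summable (\<lambda>s. norm (oham_term F N s))"
    by (rule summable_ratio_test[of \<delta> m]) (use assms in auto)
  then have "summable (oham_term F N)"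
    by (rule summable_norm_cancel_complete)
  \<comment> \<open>These sums include the index s, which is the form in
    \<open>summable_iff_convergent'\<close>; the unprimed version sums over k < n.\<close>
  moreover have "oham_partial_sum F N = (\<lambda>s. \<Sum>k\<le>s. oham_term F N k)"
    by (simp add: fun_eq_iff oham_partial_sum_def)
  ultimately show ?thesis
    by (simp add: summable_iff_convergent')
qed

end
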